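(* Let $N\ge2$ be an integer and $\lambda<0$. Consider the equation $$-w''+(N-2)w'+(N-1)w=\frac{N-1}{2}e^{-t}w^2+\lambda e^{(N-3)t}\int_0^{e^{-t}}g(s)\,ds \qquad (\ast)$$ and the three problems: (D) $w\in C^2([0,\infty))$ solves $(\ast)$ for $t\ge0$ with $w(0)=0$, $\lim_{t\to\infty}w(t)=0$, where $g\in L^1([0,1])$ and $\lim_{t\to\infty}e^{(N-3)t}\int_0^{e^{-t}}g(s)\,ds=0$; (Nav) $w\in C^2([0,\infty))$ solves $(\ast)$ for $t\ge0$ with $w'(0)-(N-1)w(0)=0$, $\lim_{t\to\infty}w(t)=0$, with $g$ as in (D); (E) $w\in C^2(\mathbb{R})$ solves $(\ast)$ for $t\in\mathbb{R}$ with $\lim_{t\to\pm\infty}w(t)=0$, where $g\in L^1([0,\infty))$ and $\lim_{t\to\pm\infty}e^{(N-3)t}\int_0^{e^{-t}}g(s)\,ds=0$. Assume in each case that $g\ge0$ a.e. and $\operatorname{ess\,sup}g>0$. Then each of the problems (D), (Nav), (E) has at least one solution.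
   Context: These are the radial Dirichlet, Navier and entire problems for $\Delta^2u=S_2[u]+\lambda f$ ($S_2$ the sum of $2\times2$ principal minors of the Hessian), obtained via $v=u'$, $w(t)=-v(e^{-t})$. *)

theory Defs
  imports "HOL-Analysis.Analysis" "HOL-Probability.Essential_Supremum"
begin

definition src :: "nat \<Rightarrow> (real \<Rightarrow> real) \<Rightarrow> real \<Rightarrow> real" where
  "src N g t = exp ((real N - 3) * t) * (LINT s:{0..exp (- t)}|lborel. g s)"

text \<open>The ODE  -w'' + (N-2) w' + (N-1) w = (N-1)/2 e^-t w^2 + lambda * src  at the point t,
  with w1, w2 standing for the first and second derivatives of w.\<close>
definition ode_at :: "nat \<Rightarrow> real \<Rightarrow> (real \<Rightarrow> real) \<Rightarrow> (real \<Rightarrow> real) \<Rightarrow> (real \<Rightarrow> real)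
    \<Rightarrow> (real \<Rightarrow> real) \<Rightarrow> real \<Rightarrow> bool" where
  "ode_at N lam g w w1 w2 t \<longleftrightarrow>
     - w2 t + (real N - 2) * w1 t + (real N - 1) * w t
       = (real N - 1) / 2 * exp (- t) * (w t)^2 + lam * src N g t"

definition C2_with :: "real set \<Rightarrow> (real \<Rightarrow> real) \<Rightarrow> (real \<Rightarrow> real) \<Rightarrow> (real \<Rightarrow> real) \<Rightarrow> bool" where
  "C2_with S w w1 w2 \<longleftrightarrow>
     (\<forall>t\<in>S. (w has_real_derivative w1 t) (at t within S)
           \<and> (w1 has_real_derivative w2 t) (at t within S))
     \<and> continuous_on S w2"

definition g_hyp_D :: "nat \<Rightarrow> (real \<Rightarrow> real) \<Rightarrow> bool" where
  "g_hyp_D N g \<longleftrightarrow>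
     set_integrable lborel {0..1} g
     \<and> ((\<lambda>t. src N g t) \<longlongrightarrow> 0) at_top
     \<and> (AE s in lborel. s \<in> {0..1} \<longrightarrow> g s \<ge> 0)
     \<and> esssup (restrict_space lborel {0..1}) (\<lambda>s. ereal (g s)) > 0"

definition g_hyp_E :: "nat \<Rightarrow> (real \<Rightarrow> real) \<Rightarrow> bool" where
  "g_hyp_E N g \<longleftrightarrow>
     set_integrable lborel {0..} g
     \<and> ((\<lambda>t. src N g t) \<longlongrightarrow> 0) at_top
     \<and> ((\<lambda>t. src N g t) \<longlongrightarrow> 0) at_bot
     \<and> (AE s in lborel. s \<in> {0..} \<longrightarrow> g s \<ge> 0)
     \<and> esssup (restrict_space lborel {0..}) (\<lambda>s. ereal (g s)) > 0"

definition solves_D :: "nat \<Rightarrow> real \<Rightarrow> (real \<Rightarrow> real) \<Rightarrow> (real \<Rightarrow> real) \<Rightarrow> bool" where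
  "solves_D N lam g w \<longleftrightarrow> (\<exists>w1 w2. C2_with {0..} w w1 w2
     \<and> (\<forall>t\<ge>0. ode_at N lam g w w1 w2 t)
     \<and> w 0 = 0 \<and> (w \<longlongrightarrow> 0) at_top)"

definition solves_Nav :: "nat \<Rightarrow> real \<Rightarrow> (real \<Rightarrow> real) \<Rightarrow> (real \<Rightarrow> real) \<Rightarrow> bool" where
  "solves_Nav N lam g w \<longleftrightarrow> (\<exists>w1 w2. C2_with {0..} w w1 w2
     \<and> (\<forall>t\<ge>0. ode_at N lam g w w1 w2 t)
     \<and> w1 0 - (real N - 1) * w 0 = 0 \<and> (w \<longlongrightarrow> 0) at_top)"

definition solves_E :: "nat \<Rightarrow> real \<Rightarrow> (real \<Rightarrow> real) \<Rightarrow> (real \<Rightarrow> real) \<Rightarrow> bool" where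
  "solves_E N lam g w \<longleftrightarrow> (\<exists>w1 w2. C2_with UNIV w w1 w2
     \<and> (\<forall>t. ode_at N lam g w w1 w2 t)
     \<and> (w \<longlongrightarrow> 0) at_top \<and> (w \<longlongrightarrow> 0) at_bot)"

end

theory Submission
  imports Defs
begin

text \<open>Write \<open>m = N - 1\<close>, \<open>w = - y\<close> and look for \<open>y \<ge> 0\<close>. Adding \<open>K y\<close> with
  \<open>K = k (1 + m + k)\<close> to both sides, the linear part becomes \<open>- (D - (m + k)) (D + (1 + k))\<close>,
  whose inverse (bounded solutions, with the boundary condition) preserves positivity and has
  sup-norm at most \<open>1 / (m + K)\<close>. The right-hand side \<open>- \<lambda> src + K y - m/2 exp (- t) y\<^sup>2\<close> is
  nonnegative and \<open>K\<close>-Lipschitz in \<open>y\<close> between 0 and a supersolution \<open>\<rho>\<close> as soon as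
  \<open>m exp (- t) \<rho> \<le> K\<close>, so Banach's theorem gives a solution. On the half-line a constant \<open>\<rho>\<close>
  works. On the line the decay of the source at \<open>-\<infinity>\<close> forces \<open>N \<ge> 4\<close> unless the source vanishes,
  and then \<open>\<rho> = C exp t\<close> works.\<close>

section \<open>Bounded solutions of first-order linear equations on the real line\<close>

lemma antiderivative_exists:
  fixes F :: "real \<Rightarrow> real"
  assumes "continuous_on UNIV F"
  obtains G where "\<And>t. (G has_real_derivative F t) (at t)"
proof -
  have "\<exists>G. \<forall>x::real. -\<infinity> < ereal x \<longrightarrow> ereal x < \<infinity> \<longrightarrow> (G has_vector_derivative F x) (at x)"
    using assms by (intro einterval_antiderivative) (auto simp: continuous_on_eq_continuous_at)
  then show ?thesis
    using that by (auto simp: has_real_derivative_iff_has_vector_derivative)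
qed

text \<open>With \<open>G\<close> an antiderivative of \<open>exp (- a t) F t\<close>, the functions
  \<open>G - M/a exp (- a t)\<close> and \<open>G + M/a exp (- a t)\<close> are increasing and decreasing respectively;
  any constant \<open>c\<close> separating them makes \<open>exp (a t) (c - G t)\<close> bounded.\<close>
lemma bounded_backward_solution:
  fixes F :: "real \<Rightarrow> real"
  assumes F: "continuous_on UNIV F" and M: "\<And>t. \<bar>F t\<bar> \<le> M" and a: "a > 0"
  obtains p where "\<And>t. (p has_real_derivative a * p t - F t) (at t)" "\<And>t. \<bar>p t\<bar> \<le> M / a"
proof -
  have "continuous_on UNIV (\<lambda>t. exp (- a * t) * F t)"
    by (intro continuous_intros F)
  then obtain G where G: "\<And>t. (G has_real_derivative exp (- a * t) * F t) (at t)"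
    using antiderivative_exists by blast
  define U where "U t = G t + M / a * exp (- a * t)" for t
  define V where "V t = G t - M / a * exp (- a * t)" for t
  have dU: "(U has_real_derivative exp (- a * t) * (F t - M)) (at t)" for t
    unfolding U_def using a
    by (auto intro!: derivative_eq_intros G simp: field_simps)
  have dV: "(V has_real_derivative exp (- a * t) * (F t + M)) (at t)" for t
    unfolding V_def using a
    by (auto intro!: derivative_eq_intros G simp: field_simps)
  have U: "U t \<le> U s" if "s \<le> t" for s t
    using that dU M
    by (intro DERIV_nonpos_imp_nonincreasing[of s t U])
       (auto intro!: exI mult_nonneg_nonpos simp: abs_le_iff)
  have V: "V s \<le> V t" if "s \<le> t" for s t
  proof (rule DERIV_nonneg_imp_nondecreasing[OF that])
    fix x have "0 \<le> F x + M" using M[of x] by linarith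
    then show "\<exists>y. DERIV V x :> y \<and> 0 \<le> y" using dV[of x] by fastforce
  qed
  have M0: "M \<ge> 0" using M[of 0] by linarith
  have VU: "V s \<le> U t" for s t
  proof -
    have "V s \<le> V (max s t)" by (rule V) simp
    also have "\<dots> \<le> U (max s t)" using M0 a by (simp add: U_def V_def)
    also have "\<dots> \<le> U t" by (rule U) simp
    finally show ?thesis .
  qed
  define c where "c = (SUP t. V t)"
  have "bdd_above (range V)" using VU by (auto intro!: bdd_aboveI)
  then have Vc: "V t \<le> c" and cU: "c \<le> U t" for t
    unfolding c_def by (auto intro!: cSUP_upper cSUP_least VU)
  define p where "p t = exp (a * t) * (c - G t)" for t
  show ?thesis
  proof
    fix t
    show "(p has_real_derivative a * p t - F t) (at t)"
      unfolding p_def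
      by (auto intro!: derivative_eq_intros G simp: algebra_simps simp flip: exp_add)
    have "\<bar>c - G t\<bar> \<le> M / a * exp (- a * t)"
      using Vc[of t] cU[of t] by (auto simp: U_def V_def abs_le_iff)
    then have "\<bar>p t\<bar> \<le> exp (a * t) * (M / a * exp (- a * t))"
      unfolding p_def abs_mult abs_exp_cancel by (rule mult_left_mono) simp
    then show "\<bar>p t\<bar> \<le> M / a"
      by (simp add: exp_minus field_simps)
  qed
qed

text \<open>Reflecting time turns the forward equation into the backward one.\<close>

lemma bounded_forward_solution:
  fixes p :: "real \<Rightarrow> real"
  assumes p: "continuous_on UNIV p" and M: "\<And>t. \<bar>p t\<bar> \<le> M" and b: "b > 0"
  obtains z where "\<And>t. (z has_real_derivative p t - b * z t) (at t)" "\<And>t. \<bar>z t\<bar> \<le> M / b"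
proof -
  have "continuous_on UNIV (\<lambda>t. p (- t))"
    by (intro continuous_on_compose2[OF p] continuous_intros) auto
  then obtain y where y: "\<And>t. (y has_real_derivative b * y t - p (- t)) (at t)"
    and yM: "\<And>t. \<bar>y t\<bar> \<le> M / b"
    using bounded_backward_solution[of "\<lambda>t. p (- t)" M b] M b by blast
  have "((\<lambda>t. y (- t)) has_real_derivative p t - b * y (- t)) (at t)" for t
    by (rule DERIV_cong[OF DERIV_chain2[where f=y and g=uminus, OF y DERIV_minus[OF DERIV_ident]]]) simp
  then show ?thesis using that yM by blast
qed

section \<open>Sign preservation for the two first-order equations\<close>

text \<open>The function \<open>exp (- a * t) * p t\<close> is nonincreasing with limit 0, hence
  nonnegative. Asking for this limit instead of boundedness later admits the barrier
  \<open>C * exp t\<close> when \<open>a > 1\<close>.\<close>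

lemma backward_nonneg:
  fixes p F :: "real \<Rightarrow> real"
  assumes p: "\<And>t. t \<ge> c \<Longrightarrow> (p has_real_derivative a * p t - F t) (at t)"
    and F: "\<And>t. t \<ge> c \<Longrightarrow> F t \<ge> 0"
    and lim: "((\<lambda>t. exp (- a * t) * p t) \<longlongrightarrow> 0) at_top"
    and t: "t \<ge> c"
  shows "p t \<ge> 0"
proof -
  have "exp (- a * s) * p s \<le> exp (- a * t) * p t" if "s \<ge> t" for s
  proof (rule DERIV_nonpos_imp_nonincreasing[OF that])
    fix x assume "t \<le> x"
    then have "((\<lambda>s. exp (- a * s) * p s) has_real_derivative - (exp (- a * x) * F x)) (at x)"
      using t by (auto intro!: derivative_eq_intros p simp: algebra_simps)
    moreover have "- (exp (- a * x) * F x) \<le> 0" using F \<open>t \<le> x\<close> t by auto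
    ultimately show "\<exists>y. ((\<lambda>s. exp (- a * s) * p s) has_real_derivative y) (at x) \<and> y \<le> 0"
      by blast
  qed
  then have "eventually (\<lambda>s. exp (- a * s) * p s \<le> exp (- a * t) * p t) at_top"
    unfolding eventually_at_top_linorder by blast
  then have "0 \<le> exp (- a * t) * p t"
    using tendsto_upperbound[OF lim] by simp
  then show ?thesis by (simp add: zero_le_mult_iff)
qed

lemma forward_mono:
  fixes z p :: "real \<Rightarrow> real"
  assumes z: "\<And>t. t \<ge> c \<Longrightarrow> (z has_real_derivative p t - b * z t) (at t)"
    and p: "\<And>t. t \<ge> c \<Longrightarrow> p t \<ge> 0"
    and "t \<ge> c"
  shows "exp (b * c) * z c \<le> exp (b * t) * z t"
proof (rule DERIV_nonneg_imp_nondecreasing[OF \<open>t \<ge> c\<close>])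
  fix x assume "c \<le> x"
  then have "((\<lambda>s. exp (b * s) * z s) has_real_derivative exp (b * x) * p x) (at x)"
    by (auto intro!: derivative_eq_intros z simp: algebra_simps)
  moreover have "0 \<le> exp (b * x) * p x" using p \<open>c \<le> x\<close> by auto
  ultimately show "\<exists>y. ((\<lambda>s. exp (b * s) * z s) has_real_derivative y) (at x) \<and> 0 \<le> y"
    by blast
qed

lemma forward_nonneg:
  fixes z p :: "real \<Rightarrow> real"
  assumes z: "\<And>t. t \<ge> c \<Longrightarrow> (z has_real_derivative p t - b * z t) (at t)"
    and p: "\<And>t. t \<ge> c \<Longrightarrow> p t \<ge> 0"
    and "z c \<ge> 0" "t \<ge> c"
  shows "z t \<ge> 0"
proof -
  have "0 \<le> exp (b * t) * z t"
    using order_trans[OF _ forward_mono[OF z p \<open>t \<ge> c\<close>]] \<open>z c \<ge> 0\<close> by simp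
  then show ?thesis by (simp add: zero_le_mult_iff)
qed

text \<open>As \<open>exp (b * t) * z t\<close> is nondecreasing, its limit 0 at
  \<open>at_bot\<close> takes the place of a nonnegative initial value.\<close>

lemma forward_nonneg_line:
  fixes z p :: "real \<Rightarrow> real"
  assumes z: "\<And>t. (z has_real_derivative p t - b * z t) (at t)"
    and p: "\<And>t. p t \<ge> 0"
    and lim: "((\<lambda>t. exp (b * t) * z t) \<longlongrightarrow> 0) at_bot"
  shows "z t \<ge> 0"
proof -
  have "eventually (\<lambda>s. exp (b * s) * z s \<le> exp (b * t) * z t) at_bot"
    unfolding eventually_at_bot_linorder using forward_mono[OF z p] by blast
  then have "0 \<le> exp (b * t) * z t"
    using tendsto_upperbound[OF lim] by simp
  then show ?thesis by (simp add: zero_le_mult_iff)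
qed

section \<open>The factored second-order operator, its barriers and its decay property\<close>

text \<open>The system \<open>p' = a p - F\<close>, \<open>z' = p - b z\<close> factors the equation
  \<open>- z'' + (a - b) z' + a b z = F\<close>.\<close>
definition factored :: "real \<Rightarrow> real \<Rightarrow> (real \<Rightarrow> real) \<Rightarrow> (real \<Rightarrow> real) \<Rightarrow> (real \<Rightarrow> real) \<Rightarrow> bool" where
  "factored a b F p z \<longleftrightarrow>
     (\<forall>t. (p has_real_derivative a * p t - F t) (at t)
        \<and> (z has_real_derivative p t - b * z t) (at t))
     \<and> ((\<lambda>t. exp (- a * t) * p t) \<longlongrightarrow> 0) at_top"

lemma factoredD:
  assumes "factored a b F p z"
  shows "(p has_real_derivative a * p t - F t) (at t)"
    and "(z has_real_derivative p t - b * z t) (at t)"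
    and "((\<lambda>t. exp (- a * t) * p t) \<longlongrightarrow> 0) at_top"
  using assms by (auto simp: factored_def)

lemma exp_mult_bounded_at_top:
  fixes p :: "real \<Rightarrow> real"
  assumes "\<And>t. \<bar>p t\<bar> \<le> M" "a > 0"
  shows "((\<lambda>t. exp (- a * t) * p t) \<longlongrightarrow> 0) at_top"
proof (rule Lim_null_comparison)
  show "eventually (\<lambda>t. norm (exp (- a * t) * p t) \<le> M * exp (- a * t)) at_top"
    using assms(1) by (auto simp: abs_mult mult.commute intro!: always_eventually)
  have "filterlim (\<lambda>t. a * t) at_top at_top"
    by (rule filterlim_tendsto_pos_mult_at_top[OF tendsto_const \<open>a > 0\<close> filterlim_ident])
  then have "((\<lambda>t. exp (- (a * t))) \<longlongrightarrow> 0) at_top"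
    by (intro filterlim_compose[OF exp_at_bot] filterlim_compose[OF filterlim_uminus_at_bot_at_top])
  then show "((\<lambda>t. M * exp (- a * t)) \<longlongrightarrow> 0) at_top"
    using tendsto_mult_right_zero by fastforce
qed

lemma exp_mult_bounded_at_bot:
  fixes p :: "real \<Rightarrow> real"
  assumes "\<And>t. \<bar>p t\<bar> \<le> M" "a > 0"
  shows "((\<lambda>t. exp (a * t) * p t) \<longlongrightarrow> 0) at_bot"
  using exp_mult_bounded_at_top[of "\<lambda>t. p (- t)" M a] assms
  by (simp add: filterlim_at_bot_mirror)

lemma factored_add:
  assumes "factored a b F p z" "factored a b G q y"
  shows "factored a b (\<lambda>t. F t + G t) (\<lambda>t. p t + q t) (\<lambda>t. z t + y t)"
  unfolding factored_def
  using tendsto_add[OF factoredD(3)[OF assms(1)] factoredD(3)[OF assms(2)]]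
  by (auto intro!: derivative_eq_intros factoredD(1,2)[OF assms(1)] factoredD(1,2)[OF assms(2)]
      simp: algebra_simps)

lemma factored_minus:
  assumes "factored a b F p z"
  shows "factored a b (\<lambda>t. - F t) (\<lambda>t. - p t) (\<lambda>t. - z t)"
  unfolding factored_def
  using tendsto_minus[OF factoredD(3)[OF assms(1)]]
  by (auto intro!: derivative_eq_intros factoredD(1,2)[OF assms(1)] simp: algebra_simps)

lemma factored_diff:
  assumes "factored a b F p z" "factored a b G q y"
  shows "factored a b (\<lambda>t. F t - G t) (\<lambda>t. p t - q t) (\<lambda>t. z t - y t)"
  using factored_add[OF assms(1) factored_minus[OF assms(2)]] by simp

lemma factored_const:
  assumes "a > 0" "b > 0"
  shows "factored a b (\<lambda>t. d) (\<lambda>t. d / a) (\<lambda>t. d / (a * b))"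
  unfolding factored_def
  using assms exp_mult_bounded_at_top[of "\<lambda>t. d / a" "\<bar>d / a\<bar>" a]
  by (auto intro!: derivative_eq_intros)

text \<open>Each first-order factor only multiplies \<open>exp t\<close>, by \<open>b + 1\<close>
  and by \<open>a - 1\<close>. The assumption \<open>a > 1\<close> makes
  \<open>exp (- a * t) * exp t\<close> vanish at infinity.\<close>

lemma factored_exp:
  assumes "a > 1"
  shows "factored a b (\<lambda>t. (a - 1) * (b + 1) * C * exp t) (\<lambda>t. (b + 1) * C * exp t) (\<lambda>t. C * exp t)"
  unfolding factored_def
  using assms exp_mult_bounded_at_top[of "\<lambda>t. (b + 1) * C" "\<bar>(b + 1) * C\<bar>" "a - 1"]
  by (auto intro!: derivative_eq_intros simp: algebra_simps simp flip: exp_add)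

lemma factored_backward_nonneg:
  assumes "factored a b F p z" "\<And>t. t \<ge> c \<Longrightarrow> F t \<ge> 0" "t \<ge> c"
  shows "p t \<ge> 0"
  by (rule backward_nonneg[of c p a F]) (use assms in \<open>auto simp: factored_def\<close>)

text \<open>From \<open>F \<ge> 0\<close> follows \<open>p 0 \<ge> 0\<close>, which gives
  \<open>z\<close> its initial sign. The boundary condition is an inequality so that the lemma
  applies to a barrier minus a solution.\<close>

lemma factored_nonneg_half:
  assumes s: "factored a b F p z" and F: "\<And>t. t \<ge> 0 \<Longrightarrow> F t \<ge> 0"
    and "0 \<le> \<gamma>" "\<gamma> * p 0 \<le> z 0" "t \<ge> 0"
  shows "z t \<ge> 0"
proof (rule forward_nonneg[of 0 z p b])
  have "0 \<le> \<gamma> * p 0" using factored_backward_nonneg[OF s F, of 0] \<open>0 \<le> \<gamma>\<close> by simp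
  then show "0 \<le> z 0" using \<open>\<gamma> * p 0 \<le> z 0\<close> by linarith
qed (use factoredD(2)[OF s] factored_backward_nonneg[OF s F] \<open>t \<ge> 0\<close> in auto)

lemma factored_nonneg_line:
  assumes s: "factored a b F p z" and F: "\<And>t. F t \<ge> 0"
    and "((\<lambda>t. exp (b * t) * z t) \<longlongrightarrow> 0) at_bot"
  shows "z t \<ge> 0"
  by (rule forward_nonneg_line[OF factoredD(2)[OF s] factored_backward_nonneg[OF s F order_refl] assms(3)])

text \<open>Constant barriers on a tail \<open>{c..}\<close> drive \<open>p\<close> to 0.
  L'Hospital's rule for \<open>(exp (b * t) * z t) / exp (b * t)\<close>, whose quotient of
  derivatives is \<open>p t / b\<close>, then passes the limit on to \<open>z\<close>.\<close>

lemma factored_tendsto_0: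
  assumes s: "factored a b F p z" and a: "a > 0" and b: "b > 0" and F: "(F \<longlongrightarrow> 0) at_top"
  shows "(z \<longlongrightarrow> 0) at_top"
proof -
  have p: "(p \<longlongrightarrow> 0) at_top"
  proof (rule tendstoI)
    fix e :: real assume "e > 0"
    then have "eventually (\<lambda>t. \<bar>F t\<bar> < a * e / 2) at_top"
      using F a by (auto dest!: tendstoD[where e="a * e / 2"] simp: dist_real_def)
    then obtain c where c: "\<And>t. t \<ge> c \<Longrightarrow> \<bar>F t\<bar> < a * e / 2"
      by (auto simp: eventually_at_top_linorder)
    \<comment> \<open>The \<open>p\<close>-component of this constant solution is
      \<open>e / 2\<close>, which leaves room for the strict bound by \<open>e\<close>.\<close>
    note k = factored_const[OF a b, of "a * e / 2"]
    have "\<bar>p t\<bar> \<le> e / 2" if "t \<ge> c" for t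
    proof -
      have "0 \<le> a * e / 2 / a + p t"
        by (rule factored_backward_nonneg[OF factored_add[OF k s] _ that])
           (use c in \<open>fastforce simp: abs_less_iff\<close>)
      moreover have "0 \<le> a * e / 2 / a - p t"
        by (rule factored_backward_nonneg[OF factored_diff[OF k s] _ that])
           (use c in \<open>fastforce simp: abs_less_iff\<close>)
      ultimately show ?thesis using a by simp
    qed
    then show "eventually (\<lambda>t. dist (p t) 0 < e) at_top"
      using \<open>e > 0\<close> by (fastforce simp: eventually_at_top_linorder dist_real_def intro!: exI[of _ c])
  qed
  have "((\<lambda>t. (exp (b * t) * z t) / exp (b * t)) \<longlongrightarrow> 0) at_top"
  proof (rule lhospital_at_top_at_top)
    show "LIM t at_top. exp (b * t) :> at_top"
      by (intro filterlim_compose[OF exp_at_top]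
          filterlim_tendsto_pos_mult_at_top[OF tendsto_const b filterlim_ident])
    show "\<forall>\<^sub>F t in at_top. b * exp (b * t) \<noteq> 0" using b by simp
    show "\<forall>\<^sub>F t in at_top. ((\<lambda>t. exp (b * t) * z t) has_real_derivative exp (b * t) * p t) (at t)"
      by (intro always_eventually allI)
         (auto intro!: derivative_eq_intros factoredD(2)[OF s] simp: algebra_simps)
    show "\<forall>\<^sub>F t in at_top. ((\<lambda>t. exp (b * t)) has_real_derivative b * exp (b * t)) (at t)"
      by (intro always_eventually allI) (auto intro!: derivative_eq_intros)
    have "((\<lambda>t. p t / b) \<longlongrightarrow> 0) at_top"
      using tendsto_divide[OF p tendsto_const, of b] b by simp
    then show "((\<lambda>t. exp (b * t) * p t / (b * exp (b * t))) \<longlongrightarrow> 0) at_top"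
      by simp
  qed
  then show ?thesis by simp
qed

lemma factored_continuous:
  assumes "factored a b F p z"
  shows "continuous_on S p" "continuous_on S z"
  using factoredD(1,2)[OF assms]
  by (meson DERIV_isCont continuous_at_imp_continuous_on)+

section \<open>Solution operators on the half-line and on the line, with comparison
  principles\<close>

text \<open>The boundary condition \<open>z(0) = \<gamma> p(0)\<close> covers the Dirichlet (\<open>\<gamma> = 0\<close>) and the Navier
  conditions. Solutions on the half-line are extended to the left by their value at 0.\<close>
definition half_sol :: "real \<Rightarrow> real \<Rightarrow> real \<Rightarrow> (real \<Rightarrow> real) \<Rightarrow> (real \<Rightarrow> real) \<Rightarrow> bool" where
  "half_sol a b \<gamma> F z \<longleftrightarrow> (\<exists>p y. factored a b F p y \<and> y 0 = \<gamma> * p 0 \<and> z = (\<lambda>t. y (max 0 t)))"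

text \<open>The limit at \<open>at_bot\<close> excludes the homogeneous solutions
  \<open>exp (- b * t)\<close>, just as the limit in \<open>factored\<close> excludes
  \<open>exp (a * t)\<close> from \<open>p\<close>.\<close>

definition line_sol :: "real \<Rightarrow> real \<Rightarrow> (real \<Rightarrow> real) \<Rightarrow> (real \<Rightarrow> real) \<Rightarrow> bool" where
  "line_sol a b F z \<longleftrightarrow> (\<exists>p. factored a b F p z \<and> ((\<lambda>t. exp (b * t) * z t) \<longlongrightarrow> 0) at_bot)"

lemma half_sol_exists:
  assumes F: "continuous_on UNIV F" "\<And>t. \<bar>F t\<bar> \<le> M" and a: "a > 0"
  shows "\<exists>z. half_sol a b \<gamma> F z"
proof -
  obtain p where p: "\<And>t. (p has_real_derivative a * p t - F t) (at t)" "\<And>t. \<bar>p t\<bar> \<le> M / a"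
    using bounded_backward_solution[OF assms] by blast
  have "continuous_on UNIV p"
    using p(1) by (auto intro!: continuous_at_imp_continuous_on DERIV_isCont)
  then have "continuous_on UNIV (\<lambda>t. exp (b * t) * p t)"
    by (intro continuous_intros)
  then obtain Q where Q: "\<And>t. (Q has_real_derivative exp (b * t) * p t) (at t)"
    using antiderivative_exists by blast
  \<comment> \<open>Variation of constants, started at \<open>\<gamma> * p 0\<close>.\<close>
  define y where "y t = exp (- b * t) * (\<gamma> * p 0 + Q t - Q 0)" for t
  have "(y has_real_derivative p t - b * y t) (at t)" for t
    unfolding y_def
    by (auto intro!: derivative_eq_intros Q simp: algebra_simps simp flip: exp_add)
  then have "factored a b F p y"
    using p(1) exp_mult_bounded_at_top[OF p(2) a] by (auto simp: factored_def)
  moreover have "y 0 = \<gamma> * p 0" by (simp add: y_def)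
  ultimately show ?thesis by (auto simp: half_sol_def)
qed

lemma line_sol_exists:
  assumes F: "continuous_on UNIV F" "\<And>t. \<bar>F t\<bar> \<le> M" and a: "a > 0" and b: "b > 0"
  shows "\<exists>z. line_sol a b F z"
proof -
  obtain p where p: "\<And>t. (p has_real_derivative a * p t - F t) (at t)" "\<And>t. \<bar>p t\<bar> \<le> M / a"
    using bounded_backward_solution[OF F a] by blast
  have "continuous_on UNIV p"
    using p(1) by (auto intro!: continuous_at_imp_continuous_on DERIV_isCont)
  then obtain z where z: "\<And>t. (z has_real_derivative p t - b * z t) (at t)"
      "\<And>t. \<bar>z t\<bar> \<le> M / a / b"
    using bounded_forward_solution[of p "M / a" b] p(2) b by blast
  have "factored a b F p z"
    using p(1) z(1) exp_mult_bounded_at_top[OF p(2) a] by (auto simp: factored_def)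
  then show ?thesis
    using exp_mult_bounded_at_bot[OF z(2) b] by (auto simp: line_sol_def)
qed

lemma half_sol_continuous:
  assumes "half_sol a b \<gamma> F z"
  shows "continuous_on UNIV z"
proof -
  obtain p y where y: "factored a b F p y" "z = (\<lambda>t. y (max 0 t))"
    using assms by (auto simp: half_sol_def)
  have "continuous_on UNIV (max 0 :: real \<Rightarrow> real)" by (intro continuous_intros)
  then show ?thesis
    unfolding y(2) by (rule continuous_on_compose2[OF factored_continuous(2)[OF y(1), of UNIV]]) simp
qed

lemma line_sol_continuous: "line_sol a b F z \<Longrightarrow> continuous_on UNIV z"
  by (auto simp: line_sol_def intro: factored_continuous(2))

lemma half_sol_tendsto_0:
  assumes "half_sol a b \<gamma> F z" "a > 0" "b > 0" "(F \<longlongrightarrow> 0) at_top"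
  shows "(z \<longlongrightarrow> 0) at_top"
proof -
  obtain p y where y: "factored a b F p y" "z = (\<lambda>t. y (max 0 t))"
    using assms(1) by (auto simp: half_sol_def)
  have "eventually (\<lambda>t. y t = z t) at_top"
    using eventually_ge_at_top[of 0] by eventually_elim (simp add: y max_def)
  then show ?thesis
    using factored_tendsto_0[OF y(1) assms(2-4)] by (rule Lim_transform_eventually[rotated])
qed

lemma line_sol_tendsto_0:
  assumes "line_sol a b F z" "a > 0" "b > 0" "(F \<longlongrightarrow> 0) at_top"
  shows "(z \<longlongrightarrow> 0) at_top"
  using assms factored_tendsto_0 by (auto simp: line_sol_def)

text \<open>The constant \<open>d / (a * b)\<close> solves the equation with right-hand side
  \<open>d\<close>, and \<open>\<gamma> * b \<le> 1\<close> makes it satisfy the boundary inequality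
  at 0. Used in both directions, this bounds the solution operator by \<open>1 / (a * b)\<close> in
  the sup-norm.\<close>

lemma half_sol_le_const:
  assumes z: "half_sol a b \<gamma> F z" and a: "a > 0" and b: "b > 0" and \<gamma>: "0 \<le> \<gamma>" "\<gamma> * b \<le> 1"
    and y: "half_sol a b \<gamma> G y" and d: "\<And>t. t \<ge> 0 \<Longrightarrow> F t - G t \<le> d" "d \<ge> 0"
  shows "z t - y t \<le> d / (a * b)"
proof -
  obtain p z' where p: "factored a b F p z'" "z' 0 = \<gamma> * p 0" "z = (\<lambda>t. z' (max 0 t))"
    using z by (auto simp: half_sol_def)
  obtain q y' where q: "factored a b G q y'" "y' 0 = \<gamma> * q 0" "y = (\<lambda>t. y' (max 0 t))"
    using y by (auto simp: half_sol_def)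
  have "\<gamma> * (d / a) \<le> d / (a * b)"
    using mult_right_mono[OF \<gamma>(2), of "d / (a * b)"] a b d(2) by (simp add: field_simps)
  then have *: "\<gamma> * (d / a - (p 0 - q 0)) \<le> d / (a * b) - (z' 0 - y' 0)"
    by (simp add: p q algebra_simps)
  have "0 \<le> d / (a * b) - (z' (max 0 t) - y' (max 0 t))"
    by (rule factored_nonneg_half[OF factored_diff[OF factored_const[OF a b, of d]
          factored_diff[OF p(1) q(1)]] _ \<gamma>(1) *]) (use d in auto)
  then show ?thesis by (simp add: p q)
qed

lemma line_sol_le_const:
  assumes z: "line_sol a b F z" and a: "a > 0" and b: "b > 0"
    and y: "line_sol a b G y" and d: "\<And>t. F t - G t \<le> d"
  shows "z t - y t \<le> d / (a * b)"
proof -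
  obtain p where p: "factored a b F p z" "((\<lambda>t. exp (b * t) * z t) \<longlongrightarrow> 0) at_bot"
    using z by (auto simp: line_sol_def)
  obtain q where q: "factored a b G q y" "((\<lambda>t. exp (b * t) * y t) \<longlongrightarrow> 0) at_bot"
    using y by (auto simp: line_sol_def)
  have "((\<lambda>t. exp (b * t) * (d / (a * b))) \<longlongrightarrow> 0) at_bot"
    by (rule exp_mult_bounded_at_bot[OF order_refl b])
  from tendsto_diff[OF this tendsto_diff[OF p(2) q(2)]]
  have "((\<lambda>t. exp (b * t) * (d / (a * b) - (z t - y t))) \<longlongrightarrow> 0) at_bot"
    by (simp add: algebra_simps)
  then have "0 \<le> d / (a * b) - (z t - y t)"
    by (intro factored_nonneg_line[OF factored_diff[OF factored_const[OF a b, of d]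
          factored_diff[OF p(1) q(1)]]]) (use d in auto)
  then show ?thesis by simp
qed

text \<open>Comparison with the barrier of \<open>factored_exp\<close>. An exponential bound is
  wanted because it compensates the factor \<open>exp (- t)\<close> of the quadratic term, which
  blows up at minus infinity.\<close>

lemma line_sol_le_exp:
  assumes z: "line_sol a b F z" and a: "a > 1" and b: "b > 0"
    and F: "\<And>t. F t \<le> (a - 1) * (b + 1) * C * exp t"
  shows "z t \<le> C * exp t"
proof -
  obtain p where p: "factored a b F p z" "((\<lambda>t. exp (b * t) * z t) \<longlongrightarrow> 0) at_bot"
    using z by (auto simp: line_sol_def)
  have "((\<lambda>t. exp ((b + 1) * t) * C) \<longlongrightarrow> 0) at_bot"
    by (rule exp_mult_bounded_at_bot[OF order_refl]) (use b in simp)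
  from tendsto_diff[OF this p(2)]
  have "((\<lambda>t. exp (b * t) * (C * exp t - z t)) \<longlongrightarrow> 0) at_bot"
    by (simp add: algebra_simps exp_add)
  then have "0 \<le> C * exp t - z t"
    by (intro factored_nonneg_line[OF factored_diff[OF factored_exp[OF a, of b C] p(1)]])
       (use F in auto)
  then show ?thesis by simp
qed

lemma half_sol_zero: "half_sol a b \<gamma> (\<lambda>t. 0) (\<lambda>t. 0)"
  unfolding half_sol_def factored_def by (intro exI[of _ "\<lambda>t. 0"]) auto

lemma line_sol_zero: "line_sol a b (\<lambda>t. 0) (\<lambda>t. 0)"
  unfolding line_sol_def factored_def by (intro exI[of _ "\<lambda>t. 0"]) auto

section \<open>The contraction argument for the shifted problem\<close>

text \<open>The shift \<open>K\<close> makes the right-hand side \<open>f + K y - q y\<^sup>2\<close> nonnegative and \<open>K\<close>-Lipschitz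
  in \<open>y \<in> [0, \<rho>]\<close>, while the solution operator has norm at most \<open>1 / \<mu>\<close> with \<open>\<mu> > K\<close>.\<close>
lemma shifted_fixed_point:
  fixes f q \<rho> :: "real \<Rightarrow> real" and Sol :: "(real \<Rightarrow> real) \<Rightarrow> (real \<Rightarrow> real) \<Rightarrow> bool"
  assumes ex: "\<And>F M. continuous_on UNIV F \<Longrightarrow> (\<And>t. \<bar>F t\<bar> \<le> M) \<Longrightarrow> \<exists>z. Sol F z"
    and cont: "\<And>F z. Sol F z \<Longrightarrow> continuous_on UNIV z"
    and zero: "Sol (\<lambda>t. 0) (\<lambda>t. 0)"
    and comp: "\<And>F G z y d t. Sol F z \<Longrightarrow> Sol G y \<Longrightarrow> (\<And>t. F t - G t \<le> d) \<Longrightarrow> d \<ge> 0 \<Longrightarrow>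
      z t - y t \<le> d / \<mu>"
    and decay: "\<And>F z. Sol F z \<Longrightarrow> (F \<longlongrightarrow> 0) at_top \<Longrightarrow> (z \<longlongrightarrow> 0) at_top"
    and super: "\<And>F z t. Sol F z \<Longrightarrow> (\<And>t. F t \<le> f t + K * \<rho> t) \<Longrightarrow> z t \<le> \<rho> t"
    and f: "continuous_on UNIV f" "\<And>t. 0 \<le> f t" "\<And>t. f t \<le> M" "(f \<longlongrightarrow> 0) at_top"
    and q: "continuous_on UNIV q" "\<And>t. 0 \<le> q t" "\<And>t. 2 * q t * \<rho> t \<le> K"
    and \<rho>: "\<And>t. 0 \<le> \<rho> t"
    and K: "0 \<le> K" "K < \<mu>"
  obtains y where "Sol (\<lambda>t. f t + K * y t - q t * (y t)\<^sup>2) y" "\<And>t. 0 \<le> y t" "\<And>t. y t \<le> \<rho> t"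
    "(y \<longlongrightarrow> 0) at_top"
proof -
  define \<Phi> where "\<Phi> y t = f t + K * y t - q t * (y t)\<^sup>2" for y t
  \<comment> \<open>Decay at infinity is part of the complete set, so the fixed point inherits
    it.\<close>
  define S where "S = {y :: real \<Rightarrow>\<^sub>C real. (\<forall>t. 0 \<le> y t \<and> y t \<le> \<rho> t) \<and> (y \<longlongrightarrow> 0) at_top}"
  have qy: "2 * (q t * y t) \<le> K" if "y \<in> S" for y t
  proof -
    have "q t * y t \<le> q t * \<rho> t"
      using that q(2) by (intro mult_left_mono) (auto simp: S_def)
    then show ?thesis using q(3)[of t] by linarith
  qed
  have qy2: "0 \<le> q t * (y t)\<^sup>2" "q t * (y t)\<^sup>2 \<le> K * y t" if "y \<in> S" for y t
  proof -
    have "0 \<le> y t" using that by (simp add: S_def)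
    then have "0 \<le> q t * y t" using q(2) by simp
    then have "q t * y t * y t \<le> K * y t" using qy[OF that, of t] \<open>0 \<le> y t\<close>
      by (intro mult_right_mono) auto
    then show "q t * (y t)\<^sup>2 \<le> K * y t" by (simp add: power2_eq_square mult_ac)
    show "0 \<le> q t * (y t)\<^sup>2" using q(2) by simp
  qed
  have step: "\<exists>x\<in>S. Sol (\<Phi> y) x" if y: "y \<in> S" for y
  proof -
    have y0: "0 \<le> y t" "y t \<le> \<rho> t" "(y \<longlongrightarrow> 0) at_top" for t using y by (auto simp: S_def)
    obtain B where B: "\<And>t. \<bar>y t\<bar> \<le> B"
      using bounded_apply_bcontfun[of y] by (auto simp: bounded_iff)
    have \<Phi>_ge: "0 \<le> \<Phi> y t" for t
      using f(2)[of t] qy2[OF y, of t] by (simp add: \<Phi>_def)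
    have \<Phi>_le: "\<Phi> y t \<le> f t + K * y t" for t
      using qy2[OF y, of t] by (simp add: \<Phi>_def)
    have \<Phi>_M: "\<Phi> y t \<le> M + K * B" for t
    proof -
      have "y t \<le> B" using B[of t] by simp
      then have "K * y t \<le> K * B" using K(1) by (rule mult_left_mono)
      then show ?thesis using \<Phi>_le[of t] f(3)[of t] by linarith
    qed
    have "continuous_on UNIV (\<Phi> y)"
      unfolding \<Phi>_def by (intro continuous_intros f q) auto
    then obtain x where x: "Sol (\<Phi> y) x"
      using ex[of "\<Phi> y" "M + K * B"] \<Phi>_ge \<Phi>_M by (auto simp: abs_of_nonneg)
    \<comment> \<open>Comparing the zero solution with \<open>x\<close> and taking
      \<open>d = 0\<close> gives the sign of \<open>x\<close>.\<close>
    have x_ge: "0 \<le> x t" for t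
      using comp[OF zero x, of 0 t] \<Phi>_ge by simp
    have "0 \<le> M + K * B" using \<Phi>_ge[of 0] \<Phi>_M[of 0] by linarith
    \<comment> \<open>Since \<open>\<rho>\<close> may be unbounded, membership of \<open>x\<close>
      in \<open>bcontfun\<close> rests on this separate constant bound.\<close>
    then have x_B: "x t \<le> (M + K * B) / \<mu>" for t
      using comp[OF x zero, of "M + K * B" t] \<Phi>_M by simp
    have x_le: "x t \<le> \<rho> t" for t
    proof (rule super[OF x])
      fix t show "\<Phi> y t \<le> f t + K * \<rho> t"
        using \<Phi>_le[of t] mult_left_mono[OF y0(2)[of t] K(1)] by linarith
    qed
    have "(\<Phi> y \<longlongrightarrow> 0) at_top"
    proof (rule tendsto_sandwich[OF _ _ tendsto_const])
      show "((\<lambda>t. f t + K * y t) \<longlongrightarrow> 0) at_top"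
        using tendsto_add[OF f(4) tendsto_mult_right_zero[OF y0(3), of K]] by simp
    qed (use \<Phi>_ge \<Phi>_le in auto)
    then have x_lim: "(x \<longlongrightarrow> 0) at_top" by (rule decay[OF x])
    have "x \<in> bcontfun"
      using cont[OF x] x_ge x_B by (auto simp: bcontfun_def bounded_iff intro!: exI[of _ "(M + K * B) / \<mu>"])
    then obtain x' where x': "x = apply_bcontfun x'" by (rule bcontfunE)
    then show ?thesis using x x_ge x_le x_lim by (auto simp: S_def intro!: bexI[of _ x'])
  qed
  \<comment> \<open>\<open>Sol\<close> is a relation, so \<open>T\<close> picks one solution for
    each \<open>y\<close>; the estimate \<open>contr\<close> holds for any such choice.\<close>
  then obtain T where T: "\<And>y. y \<in> S \<Longrightarrow> T y \<in> S \<and> Sol (\<Phi> y) (T y)"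
    by metis
  have lip: "\<Phi> y t - \<Phi> x t \<le> K * dist y x" if y: "y \<in> S" and x: "x \<in> S" for y x t
  proof -
    \<comment> \<open>Both \<open>q t * y t\<close> and \<open>q t * x t\<close> lie in
      \<open>[0, K / 2]\<close>, so the first factor lies in \<open>[0, K]\<close>.\<close>
    have "\<Phi> y t - \<Phi> x t = (K - q t * y t - q t * x t) * (y t - x t)"
      by (simp add: \<Phi>_def power2_eq_square algebra_simps)
    also have "\<dots> \<le> \<bar>K - q t * y t - q t * x t\<bar> * \<bar>y t - x t\<bar>"
      by (metis abs_ge_self abs_mult)
    also have "\<dots> \<le> K * dist y x"
    proof (rule mult_mono)
      have "0 \<le> q t * y t" "0 \<le> q t * x t" using x y q(2)[of t] by (auto simp: S_def)
      then show "\<bar>K - q t * y t - q t * x t\<bar> \<le> K"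
        using qy[OF y, of t] qy[OF x, of t] by linarith
      show "\<bar>y t - x t\<bar> \<le> dist y x"
        using dist_bounded[of y t x] by (simp add: dist_real_def)
    qed (use K in auto)
    finally show ?thesis .
  qed
  have contr: "dist (T y) (T x) \<le> K / \<mu> * dist y x" if y: "y \<in> S" and x: "x \<in> S" for y x
  proof (rule dist_bound)
    fix t
    have "0 \<le> K * dist y x" using K(1) by simp
    then have "T y t - T x t \<le> K * dist y x / \<mu>" "T x t - T y t \<le> K * dist y x / \<mu>"
      using comp[of "\<Phi> y" "T y" "\<Phi> x" "T x" "K * dist y x"] lip[OF y x]
        comp[of "\<Phi> x" "T x" "\<Phi> y" "T y" "K * dist y x"] lip[OF x y] T x y
      by (auto simp: dist_commute)
    then show "dist (T y t) (T x t) \<le> K / \<mu> * dist y x"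
      by (auto simp: dist_real_def abs_le_iff)
  qed
  \<comment> \<open>The pointwise bounds and the decay both survive uniform limits.\<close>
  have "closed S"
    unfolding closure_subset_eq[symmetric]
  proof
    fix l assume "l \<in> closure S"
    then have near: "\<exists>y\<in>S. \<forall>t. \<bar>y t - l t\<bar> < e" if "e > 0" for e
      using \<open>e > 0\<close> dist_fun_lt_imp_dist_val_lt unfolding closure_approachable dist_real_def[symmetric]
      by blast
    have "0 \<le> l t" "l t \<le> \<rho> t" for t
    proof -
      have "- l t \<le> 0 + e" "l t \<le> \<rho> t + e" if e: "e > 0" for e
      proof -
        obtain y where y: "y \<in> S" "\<And>t. \<bar>y t - l t\<bar> < e" using near[OF e] by blast
        have "0 \<le> y t" "y t \<le> \<rho> t" using y(1) by (auto simp: S_def)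
        with y(2)[of t] show "- l t \<le> 0 + e" "l t \<le> \<rho> t + e" by linarith+
      qed
      then have "- l t \<le> 0" "l t \<le> \<rho> t" using field_le_epsilon by blast+
      then show "0 \<le> l t" "l t \<le> \<rho> t" by auto
    qed
    moreover have "(l \<longlongrightarrow> 0) at_top"
    proof (rule tendstoI)
      fix e :: real assume e: "e > 0"
      obtain y where y: "y \<in> S" "\<And>t. \<bar>y t - l t\<bar> < e / 2" using near[of "e / 2"] e by auto
      have "(y \<longlongrightarrow> 0) at_top" using y(1) by (simp add: S_def)
      then have "eventually (\<lambda>t. dist (y t) 0 < e / 2) at_top"
        by (rule tendstoD) (use e in simp)
      then show "eventually (\<lambda>t. dist (l t) 0 < e) at_top"
      proof eventually_elim
        case (elim t)
        then show ?case using y(2)[of t] unfolding dist_real_def by linarith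
      qed
    qed
    ultimately show "l \<in> S" by (simp add: S_def)
  qed
  then have "complete S" by (simp add: complete_eq_closed)
  moreover have "const_bcontfun 0 \<in> S"
    using \<rho> by (simp add: S_def const_bcontfun.rep_eq)
  ultimately obtain y where y: "y \<in> S" "T y = y"
    using Banach_fix[of S "K / \<mu>" T] contr T K by (auto simp: divide_less_eq)
  then have "Sol (\<lambda>t. f t + K * y t - q t * (y t)\<^sup>2) y"
    using T[OF y(1)] by (simp add: \<Phi>_def[abs_def])
  then show ?thesis
    using that[of y] y(1) by (auto simp: S_def)
qed

section \<open>Boundedness, continuity and sign of the source\<close>

lemma bounded_if_tendsto_0_at_top:
  fixes h :: "real \<Rightarrow> real"
  assumes h: "continuous_on {c..} h" and lim: "(h \<longlongrightarrow> 0) at_top"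
  obtains M where "M \<ge> 0" "\<And>t. t \<ge> c \<Longrightarrow> \<bar>h t\<bar> \<le> M"
proof -
  have "eventually (\<lambda>t. \<bar>h t\<bar> < 1) at_top"
    using tendstoD[OF lim, of 1] by (simp add: dist_real_def)
  then obtain d where d: "\<And>t. t \<ge> d \<Longrightarrow> \<bar>h t\<bar> < 1"
    by (auto simp: eventually_at_top_linorder)
  have "bounded (h ` {c..d})"
    by (intro compact_imp_bounded compact_continuous_image continuous_on_subset[OF h]) auto
  then obtain B where B: "\<And>t. t \<in> {c..d} \<Longrightarrow> \<bar>h t\<bar> \<le> B"
    unfolding bounded_iff by fastforce
  show ?thesis
  proof
    show "\<bar>h t\<bar> \<le> max 1 B" if "t \<ge> c" for t
      using d[of t] B[of t] that by (cases "t \<ge> d") (auto simp: max_def)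
  qed simp
qed

text \<open>Rests on continuity of the indefinite integral. The restriction
  \<open>exp (- t) \<le> R\<close> keeps the upper limit of integration where \<open>g\<close> is
  known to be integrable.\<close>

lemma src_continuous_on:
  assumes "set_integrable lborel {0..R} g"
  shows "continuous_on {t. exp (- t) \<le> R} (src N g)"
proof -
  define I where "I r = integral {0..r} g" for r
  have g: "g integrable_on {0..R}"
    using set_borel_integral_eq_integral(1)[OF assms] .
  have "src N g t = exp ((real N - 3) * t) * I (exp (- t))" if "exp (- t) \<le> R" for t
  proof -
    have "set_integrable lborel {0..exp (- t)} g"
      by (rule set_integrable_subset[OF assms]) (use that in auto)
    then show ?thesis
      unfolding src_def I_def by (simp add: set_borel_integral_eq_integral(2))
  qed
  moreover have "continuous_on {t. exp (- t) \<le> R} (\<lambda>t. exp ((real N - 3) * t) * I (exp (- t)))"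
    unfolding I_def
    by (intro continuous_intros continuous_on_compose2[OF indefinite_integral_continuous_1[OF g]]) auto
  ultimately show ?thesis
    by (simp cong: continuous_on_cong_simp)
qed

lemma set_integral_nonneg_mono:
  fixes g :: "real \<Rightarrow> real"
  assumes g: "set_integrable lborel B g" and nn: "AE s in lborel. s \<in> B \<longrightarrow> g s \<ge> 0"
    and "A \<subseteq> B" "A \<in> sets lborel"
  shows "0 \<le> (LINT s:A|lborel. g s)" "(LINT s:A|lborel. g s) \<le> (LINT s:B|lborel. g s)"
proof -
  have A: "set_integrable lborel A g" using set_integrable_subset[OF g] assms by blast
  show "0 \<le> (LINT s:A|lborel. g s)"
    unfolding set_lebesgue_integral_def
    using nn \<open>A \<subseteq> B\<close> by (intro integral_nonneg_AE) (auto simp: indicator_def elim!: eventually_mono)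
  show "(LINT s:A|lborel. g s) \<le> (LINT s:B|lborel. g s)"
    unfolding set_lebesgue_integral_def
    using nn \<open>A \<subseteq> B\<close> A g
    by (intro integral_mono_AE) (auto simp: indicator_def set_integrable_def elim!: eventually_mono)
qed

lemma src_nonneg:
  assumes "set_integrable lborel B g" "AE s in lborel. s \<in> B \<longrightarrow> g s \<ge> 0" "{0..exp (- t)} \<subseteq> B"
  shows "0 \<le> src N g t"
  unfolding src_def using set_integral_nonneg_mono(1)[OF assms] by simp

section \<open>Existence for the original equation\<close>

text \<open>With \<open>a = m + k\<close> and \<open>b = 1 + k\<close> one has
  \<open>a - b = N - 2\<close> and \<open>a * b = m + k * (1 + m + k)\<close>, so the shift cancels
  and \<open>w = - z\<close> solves the equation. The relation for \<open>F\<close> is asked on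
  \<open>S\<close> only, since on the half-line the source is altered for negative times.\<close>

lemma factored_solves_ode:
  fixes N :: nat
  defines "m \<equiv> real N - 1"
  assumes s: "factored (m + k) (1 + k) F p z" and F: "continuous_on UNIV F"
    and eq: "\<And>t. t \<in> S \<Longrightarrow>
      F t = - lam * src N g t + k * (1 + m + k) * z t - m / 2 * exp (- t) * (z t)\<^sup>2"
  shows "\<exists>w2. C2_with S (\<lambda>t. - z t) (\<lambda>t. (1 + k) * z t - p t) w2
    \<and> (\<forall>t\<in>S. ode_at N lam g (\<lambda>t. - z t) (\<lambda>t. (1 + k) * z t - p t) w2 t)"
proof -
  define w2 where "w2 t = (1 + k) * (p t - (1 + k) * z t) - ((m + k) * p t - F t)" for t
  have "((\<lambda>t. (1 + k) * z t - p t) has_real_derivative w2 t) (at t within S)" for t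
    unfolding w2_def
    by (auto intro!: derivative_eq_intros has_field_derivative_at_within[OF factoredD(1)[OF s]]
        has_field_derivative_at_within[OF factoredD(2)[OF s]])
  moreover have "((\<lambda>t. - z t) has_real_derivative (1 + k) * z t - p t) (at t within S)" for t
    by (auto intro!: derivative_eq_intros has_field_derivative_at_within[OF factoredD(2)[OF s]])
  moreover have "continuous_on S w2"
    unfolding w2_def
    by (intro continuous_intros factored_continuous[OF s] continuous_on_subset[OF F]) auto
  moreover have "ode_at N lam g (\<lambda>t. - z t) (\<lambda>t. (1 + k) * z t - p t) w2 t" if "t \<in> S" for t
    unfolding ode_at_def w2_def eq[OF that] by (simp add: m_def algebra_simps)
  ultimately show ?thesis by (auto simp: C2_with_def intro!: exI[of _ w2])
qed

text \<open>The parameter \<open>\<gamma>\<close> is a function of \<open>b\<close> because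
  \<open>b = 1 + k\<close> is fixed only inside the proof, from a bound on the source, while the
  Navier coefficient depends on \<open>b\<close>. Exposing \<open>p\<close> and
  \<open>w' = b z - p\<close> lets both boundary conditions be read off.\<close>

lemma half_line_solution:
  fixes N :: nat and lam :: real
  defines "m \<equiv> real N - 1"
  assumes N: "N \<ge> 2" and lam: "lam < 0" and g: "g_hyp_D N g"
    and \<gamma>: "\<And>b. b > 0 \<Longrightarrow> 0 \<le> \<gamma> b" "\<And>b. b > 0 \<Longrightarrow> \<gamma> b * b \<le> 1"
  obtains b p z w2 where "b > 0" "z 0 = \<gamma> b * p 0"
    "C2_with {0..} (\<lambda>t. - z t) (\<lambda>t. b * z t - p t) w2"
    "\<forall>t\<ge>0. ode_at N lam g (\<lambda>t. - z t) (\<lambda>t. b * z t - p t) w2 t"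
    "((\<lambda>t. - z t) \<longlongrightarrow> 0) at_top"
proof -
  have gi: "set_integrable lborel {0..1} g" and gl: "(src N g \<longlongrightarrow> 0) at_top"
    and gn: "AE s in lborel. s \<in> {0..1} \<longrightarrow> g s \<ge> 0"
    using g by (auto simp: g_hyp_D_def)
  have m: "m \<ge> 1" using N by (simp add: m_def)
  have cont: "continuous_on {0..} (src N g)"
    by (rule continuous_on_subset[OF src_continuous_on[OF gi]]) auto
  \<comment> \<open>Freezing the source at time 0 extends it continuously to the whole line,
    although \<open>g\<close> is controlled on \<open>{0..1}\<close> only.\<close>
  define f where "f t = - lam * src N g (max 0 t)" for t
  have fc: "continuous_on UNIV f"
    unfolding f_def by (intro continuous_intros continuous_on_compose2[OF cont]) auto
  have fn: "0 \<le> f t" for t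
    unfolding f_def using lam by (intro mult_nonneg_nonneg src_nonneg[OF gi gn]) auto
  have "((\<lambda>t. - lam * src N g t) \<longlongrightarrow> 0) at_top"
    by (rule tendsto_mult_right_zero[OF gl])
  moreover have "eventually (\<lambda>t. - lam * src N g t = f t) at_top"
    using eventually_ge_at_top[of 0] by eventually_elim (simp add: f_def max_def)
  ultimately have fl: "(f \<longlongrightarrow> 0) at_top"
    by (rule Lim_transform_eventually)
  obtain M where M: "M \<ge> 0" "\<And>t. t \<ge> 0 \<Longrightarrow> \<bar>f t\<bar> \<le> M"
    using bounded_if_tendsto_0_at_top[OF continuous_on_subset[OF fc] fl, of 0] by auto
  have fM: "f t \<le> M" for t
    using M(2)[of "max 0 t"] by (simp add: f_def)
  \<comment> \<open>For the constant supersolution \<open>\<rho> = M\<close> this gives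
    \<open>2 * q t * M \<le> m * M = k \<le> K\<close>.\<close>
  define k where "k = m * M"
  define K where "K = k * (1 + m + k)"
  define q where "q t = m / 2 * exp (- max 0 t)" for t
  have k: "k \<ge> 0" using m M by (simp add: k_def)
  have kK: "k \<le> K" using k m mult_left_mono[of 1 "1 + m + k" k] by (simp add: K_def)
  have ab: "m + k > 0" "1 + k > 0" using k m by auto
  have \<mu>: "(m + k) * (1 + k) = m + K" by (simp add: K_def algebra_simps)
  note \<gamma>' = \<gamma>[OF ab(2)]
  obtain y where y: "half_sol (m + k) (1 + k) (\<gamma> (1 + k)) (\<lambda>t. f t + K * y t - q t * (y t)\<^sup>2) y"
      "(y \<longlongrightarrow> 0) at_top"
  proof (rule shifted_fixed_point[where Sol="half_sol (m + k) (1 + k) (\<gamma> (1 + k))"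
        and f=f and K=K and q=q and \<rho>="\<lambda>t. M" and \<mu>="(m + k) * (1 + k)" and M=M])
    show "\<exists>z. half_sol (m + k) (1 + k) (\<gamma> (1 + k)) F z"
      if "continuous_on UNIV F" "\<And>t. \<bar>F t\<bar> \<le> B" for F B
      using half_sol_exists[OF that ab(1)] .
    show "z t \<le> M" if z: "half_sol (m + k) (1 + k) (\<gamma> (1 + k)) F z"
      and F: "\<And>t. F t \<le> f t + K * M" for F z t
    proof -
      \<comment> \<open>\<open>M\<close> is a supersolution because
        \<open>M + K * M \<le> (m + K) * M\<close>, by \<open>m \<ge> 1\<close>.\<close>
      have "F t - 0 \<le> (m + k) * (1 + k) * M" for t
      proof -
        have "M \<le> m * M" using mult_right_mono[OF m M(1)] by simp
        then show ?thesis using F[of t] fM[of t] by (simp only: \<mu> distrib_right[of m K M])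
      qed
      then have "z t - 0 \<le> (m + k) * (1 + k) * M / ((m + k) * (1 + k))"
        using ab M(1) by (intro half_sol_le_const[OF z ab \<gamma>' half_sol_zero]) auto
      then show ?thesis using ab by simp
    qed
    show "2 * q t * M \<le> K" for t
    proof -
      have "exp (- max 0 t) * (m * M) \<le> 1 * (m * M)"
        using k by (intro mult_right_mono) (auto simp: k_def)
      then show ?thesis using kK by (simp add: q_def k_def mult_ac)
    qed
    show "continuous_on UNIV q" unfolding q_def by (intro continuous_intros)
    show "continuous_on UNIV z" if "half_sol (m + k) (1 + k) (\<gamma> (1 + k)) F z" for F z
      using half_sol_continuous[OF that] .
    show "z t - y t \<le> d / ((m + k) * (1 + k))"
      if "half_sol (m + k) (1 + k) (\<gamma> (1 + k)) F z" "half_sol (m + k) (1 + k) (\<gamma> (1 + k)) G y"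
        "\<And>t. F t - G t \<le> d" "d \<ge> 0" for F G z y d t
      using half_sol_le_const[OF that(1) ab \<gamma>' that(2,3,4)] .
    show "(z \<longlongrightarrow> 0) at_top"
      if "half_sol (m + k) (1 + k) (\<gamma> (1 + k)) F z" "(F \<longlongrightarrow> 0) at_top" for F z
      using half_sol_tendsto_0[OF that(1) ab that(2)] .
    show "0 \<le> q t" for t using m by (simp add: q_def)
    show "K < (m + k) * (1 + k)" "0 \<le> K" using m k kK \<mu> by auto
  qed (rule half_sol_zero fc fn fM fl M(1) | blast)+
  define F where "F t = f t + K * y t - q t * (y t)\<^sup>2" for t
  obtain p z where z: "factored (m + k) (1 + k) F p z" "z 0 = \<gamma> (1 + k) * p 0"
    and yz: "y = (\<lambda>t. z (max 0 t))"
    using y(1) unfolding half_sol_def F_def[abs_def, symmetric] by blast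
  have Fc: "continuous_on UNIV F"
    unfolding F_def q_def by (intro continuous_intros fc half_sol_continuous[OF y(1)])
  have "\<exists>w2. C2_with {0..} (\<lambda>t. - z t) (\<lambda>t. (1 + k) * z t - p t) w2
    \<and> (\<forall>t\<in>{0..}. ode_at N lam g (\<lambda>t. - z t) (\<lambda>t. (1 + k) * z t - p t) w2 t)"
    using z(1) Fc unfolding m_def
    by (rule factored_solves_ode) (simp add: F_def f_def K_def q_def yz max_def m_def)
  then obtain w2 where "C2_with {0..} (\<lambda>t. - z t) (\<lambda>t. (1 + k) * z t - p t) w2"
    "\<forall>t\<ge>0. ode_at N lam g (\<lambda>t. - z t) (\<lambda>t. (1 + k) * z t - p t) w2 t" by auto
  moreover have "((\<lambda>t. - z t) \<longlongrightarrow> 0) at_top"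
  proof -
    have "eventually (\<lambda>t. - y t = - z t) at_top"
      using eventually_ge_at_top[of 0] by eventually_elim (simp add: yz max_def)
    moreover have "((\<lambda>t. - y t) \<longlongrightarrow> 0) at_top"
      using tendsto_minus[OF y(2)] by simp
    ultimately show ?thesis
      by (rule Lim_transform_eventually[rotated])
  qed
  ultimately show ?thesis using that ab(2) z(2) by blast
qed

lemma solves_E_exists:
  assumes lam: "lam < 0" and g: "g_hyp_E N g"
  shows "\<exists>w. solves_E N lam g w"
proof -
  have gi: "set_integrable lborel {0..} g" and gl: "(src N g \<longlongrightarrow> 0) at_top"
    and gb: "(src N g \<longlongrightarrow> 0) at_bot"
    and gn: "AE s in lborel. s \<in> {0..} \<longrightarrow> g s \<ge> 0"
    using g by (auto simp: g_hyp_E_def)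
  define G where "G r = (LINT s:{0..r}|lborel. g s)" for r
  have sn: "0 \<le> src N g t" for t by (rule src_nonneg[OF gi gn]) auto
  have G_nonneg: "0 \<le> G r" for r
    unfolding G_def by (rule set_integral_nonneg_mono(1)[OF gi gn]) auto
  have G_mono: "G r \<le> G s" if "r \<le> s" for r s
    unfolding G_def
    by (rule set_integral_nonneg_mono(2)[OF set_integrable_subset[OF gi]])
       (use gn that in \<open>auto elim!: eventually_mono\<close>)
  have src_G: "src N g t = exp ((real N - 3) * t) * G (exp (- t))" for t
    by (simp add: src_def G_def)
  show ?thesis
  proof (cases "N \<le> 3")
    \<comment> \<open>Here the decay of the source at \<open>-\<infinity>\<close> forces it to vanish.\<close>
    case True
    have "G r \<le> 0" for r
    proof (rule tendsto_lowerbound[OF gb])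
      \<comment> \<open>For very negative \<open>t\<close> the exponential factor is at least 1 and
        the integral already reaches beyond \<open>r\<close>.\<close>
      show "eventually (\<lambda>t. G r \<le> src N g t) at_bot"
        using eventually_le_at_bot[of "- \<bar>r\<bar>"]
      proof eventually_elim
        case (elim t)
        then have "r \<le> exp (- t)" "t \<le> 0" using exp_ge_add_one_self[of "- t"] by linarith+
        then have "1 * G r \<le> exp ((real N - 3) * t) * G (exp (- t))"
          using True \<open>t \<le> 0\<close> by (intro mult_mono G_mono G_nonneg) (auto simp: mult_nonpos_nonpos)
        then show ?case by (simp add: src_G)
      qed
    qed simp
    then have "G r = 0" for r using G_nonneg[of r] by (simp add: antisym)
    then have "src N g t = 0" for t by (simp add: src_G)
    then have "solves_E N lam g (\<lambda>t. 0)"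
      unfolding solves_E_def C2_with_def ode_at_def
      by (intro exI[of _ "\<lambda>t. 0"]) auto
    then show ?thesis by blast
  next
    case False
    define m where "m = real N - 1"
    have m: "m \<ge> 3" using False by (simp add: m_def)
    have cont: "continuous_on UNIV (src N g)"
    proof (rule continuous_at_imp_continuous_on, rule ballI)
      fix t :: real
      \<comment> \<open>The upper limit \<open>exp (1 - t)\<close> covers all times from
        \<open>t - 1\<close> on, a neighbourhood of \<open>t\<close>.\<close>
      have "set_integrable lborel {0..exp (1 - t)} g"
        by (rule set_integrable_subset[OF gi]) auto
      from src_continuous_on[OF this, of N]
      have "continuous_on {t - 1<..} (src N g)"
        by (rule continuous_on_subset) auto
      then show "isCont (src N g) t"
        by (simp add: continuous_on_eq_continuous_at)
    qed
    define f where "f t = - lam * src N g t" for t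
    have fc: "continuous_on UNIV f" unfolding f_def by (intro continuous_intros cont)
    have fn: "0 \<le> f t" for t using lam sn by (simp add: f_def mult_nonpos_nonneg)
    have fl: "(f \<longlongrightarrow> 0) at_top" unfolding f_def by (rule tendsto_mult_right_zero[OF gl])
    obtain M0 where M0: "M0 \<ge> 0" "\<And>t. t \<ge> 0 \<Longrightarrow> \<bar>f t\<bar> \<le> M0"
      using bounded_if_tendsto_0_at_top[OF continuous_on_subset[OF fc] fl, of 0] by auto
    define Ginf where "Ginf = (LINT s:{0..}|lborel. g s)"
    have Ginf: "G r \<le> Ginf" for r
      unfolding G_def Ginf_def by (rule set_integral_nonneg_mono(2)[OF gi gn]) auto
    \<comment> \<open>One constant serves both sides: \<open>M0\<close> bounds \<open>f\<close> for
      \<open>t \<ge> 0\<close>, and for \<open>t \<le> 0\<close> the inequality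
      \<open>exp ((N - 3) * t) \<le> exp t\<close>, valid as \<open>N \<ge> 4\<close>, gives
      \<open>f t \<le> - lam * Ginf * exp t\<close>.\<close>
    define C where "C = max M0 (- lam * Ginf)"
    have C: "C \<ge> 0" using M0(1) by (simp add: C_def)
    have f_neg: "f t \<le> C * exp t" if "t \<le> 0" for t
    proof -
      have "1 * (- t) \<le> (real N - 3) * (- t)"
        using False that by (intro mult_right_mono) auto
      then have "exp ((real N - 3) * t) \<le> exp t" by simp
      then have "src N g t \<le> exp t * Ginf"
        unfolding src_G by (intro mult_mono Ginf G_nonneg) auto
      then have "f t \<le> - lam * (exp t * Ginf)"
        unfolding f_def using lam by (intro mult_left_mono) auto
      also have "\<dots> = (- lam * Ginf) * exp t" by simp
      also have "\<dots> \<le> C * exp t" by (intro mult_right_mono) (auto simp: C_def)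
      finally show ?thesis .
    qed
    have f_pos: "f t \<le> C" if "t \<ge> 0" for t
      using M0(2)[OF that] by (auto simp: C_def abs_le_iff le_max_iff_disj)
    have fe: "f t \<le> C * exp t" for t
    proof (cases "t \<ge> 0")
      case True
      then show ?thesis using f_pos[OF True] mult_left_mono[of 1 "exp t" C] C by simp
    qed (use f_neg in simp)
    have fM: "f t \<le> C" for t
    proof (cases "t \<ge> 0")
      case False
      then show ?thesis using fe[of t] mult_left_mono[of "exp t" 1 C] C by simp
    qed (use f_pos in simp)
    \<comment> \<open>For \<open>\<rho> = C * exp t\<close> the exponentials cancel, so
      \<open>2 * q t * \<rho> t = m * C = k \<le> K\<close>.\<close>
    define k where "k = m * C"
    define K where "K = k * (1 + m + k)"
    define q where "q t = m / 2 * exp (- t)" for t :: real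
    have k: "k \<ge> 0" using m C by (simp add: k_def)
    have kK: "k \<le> K" using k m mult_left_mono[of 1 "1 + m + k" k] by (simp add: K_def)
    have ab: "m + k > 0" "1 + k > 0" "m + k > 1" using k m by auto
    have \<mu>: "(m + k) * (1 + k) = m + K" by (simp add: K_def algebra_simps)
    obtain z where z: "line_sol (m + k) (1 + k) (\<lambda>t. f t + K * z t - q t * (z t)\<^sup>2) z"
      "\<And>t. 0 \<le> z t" "\<And>t. z t \<le> C * exp t" "(z \<longlongrightarrow> 0) at_top"
    proof (rule shifted_fixed_point[where Sol="line_sol (m + k) (1 + k)"
          and f=f and K=K and q=q and \<rho>="\<lambda>t. C * exp t" and \<mu>="(m + k) * (1 + k)" and M=C])
      show "\<exists>z. line_sol (m + k) (1 + k) F z"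
        if "continuous_on UNIV F" "\<And>t. \<bar>F t\<bar> \<le> B" for F B
        using line_sol_exists[OF that ab(1,2)] .
      show "z t \<le> C * exp t" if z: "line_sol (m + k) (1 + k) F z"
        and F: "\<And>t. F t \<le> f t + K * (C * exp t)" for F z t
      proof (rule line_sol_le_exp[OF z ab(3,2)])
        fix t
        have "F t \<le> (1 + K) * (C * exp t)"
          using F[of t] fe[of t] by (simp add: algebra_simps)
        \<comment> \<open>The barrier coefficient \<open>(m + k - 1) * (k + 2)\<close> equals
          \<open>2 * (m - 1) + K\<close>, and \<open>m \<ge> 3\<close> makes it exceed
          \<open>1 + K\<close>.\<close>
        also have "\<dots> \<le> (2 * (m - 1) + K) * (C * exp t)"
          using m C by (intro mult_right_mono) auto
        also have "\<dots> = (m + k - 1) * (1 + k + 1) * C * exp t"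
          by (simp add: K_def algebra_simps)
        finally show "F t \<le> (m + k - 1) * (1 + k + 1) * C * exp t" .
      qed
      show "2 * q t * (C * exp t) \<le> K" for t
        using kK by (simp add: q_def k_def exp_minus field_simps)
      show "continuous_on UNIV q" unfolding q_def by (intro continuous_intros)
      show "continuous_on UNIV z" if "line_sol (m + k) (1 + k) F z" for F z
        using line_sol_continuous[OF that] .
      show "z t - y t \<le> d / ((m + k) * (1 + k))"
        if "line_sol (m + k) (1 + k) F z" "line_sol (m + k) (1 + k) G y"
          "\<And>t. F t - G t \<le> d" for F G z y d t
        using line_sol_le_const[OF that(1) ab(1,2) that(2,3)] .
      show "(z \<longlongrightarrow> 0) at_top"
        if "line_sol (m + k) (1 + k) F z" "(F \<longlongrightarrow> 0) at_top" for F z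
        using line_sol_tendsto_0[OF that(1) ab(1,2) that(2)] .
      show "0 \<le> q t" for t using m by (simp add: q_def)
      show "0 \<le> C * exp t" for t using C by simp
      show "K < (m + k) * (1 + k)" "0 \<le> K" using m k kK \<mu> by auto
    qed (rule line_sol_zero fc fn fM fl | blast)+
    define F where "F t = f t + K * z t - q t * (z t)\<^sup>2" for t
    obtain p where p: "factored (m + k) (1 + k) F p z"
      using z(1) unfolding line_sol_def F_def[abs_def, symmetric] by blast
    have Fc: "continuous_on UNIV F"
      unfolding F_def q_def by (intro continuous_intros fc line_sol_continuous[OF z(1)])
    have "\<exists>w2. C2_with UNIV (\<lambda>t. - z t) (\<lambda>t. (1 + k) * z t - p t) w2
      \<and> (\<forall>t\<in>UNIV. ode_at N lam g (\<lambda>t. - z t) (\<lambda>t. (1 + k) * z t - p t) w2 t)"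
      using p Fc unfolding m_def
      by (rule factored_solves_ode) (simp add: F_def f_def K_def q_def m_def)
    moreover have "((\<lambda>t. - z t) \<longlongrightarrow> 0) at_top" using tendsto_minus[OF z(4)] by simp
    moreover have "((\<lambda>t. - z t) \<longlongrightarrow> 0) at_bot"
    proof -
      \<comment> \<open>Decay at minus infinity comes from the supersolution:
        \<open>0 \<le> z t \<le> C * exp t\<close>.\<close>
      have "(z \<longlongrightarrow> 0) at_bot"
        by (rule tendsto_sandwich[OF _ _ tendsto_const tendsto_mult_right_zero[OF exp_at_bot, of C]])
           (use z in auto)
      then show ?thesis using tendsto_minus by fastforce
    qed
    ultimately show ?thesis unfolding solves_E_def by blast
  qed
qed

theorem theorem4p15:
  fixes N :: nat and lam :: real
  assumes "N \<ge> 2" and "lam < 0"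
  shows "(\<forall>g. g_hyp_D N g \<longrightarrow> (\<exists>w. solves_D N lam g w))
       \<and> (\<forall>g. g_hyp_D N g \<longrightarrow> (\<exists>w. solves_Nav N lam g w))
       \<and> (\<forall>g. g_hyp_E N g \<longrightarrow> (\<exists>w. solves_E N lam g w))"
proof (intro conjI allI impI)
  fix g assume g: "g_hyp_D N g"
  obtain b p z w2 where "z 0 = 0 * p 0"
    "C2_with {0..} (\<lambda>t. - z t) (\<lambda>t. b * z t - p t) w2"
    "\<forall>t\<ge>0. ode_at N lam g (\<lambda>t. - z t) (\<lambda>t. b * z t - p t) w2 t"
    "((\<lambda>t. - z t) \<longlongrightarrow> 0) at_top"
    by (rule half_line_solution[OF assms g, of "\<lambda>b. 0"]) auto
  then have "solves_D N lam g (\<lambda>t. - z t)" unfolding solves_D_def by auto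
  then show "\<exists>w. solves_D N lam g w" by blast
next
  fix g assume g: "g_hyp_D N g"
  have m: "real N - 1 \<ge> 1" using assms by simp
  \<comment> \<open>In terms of \<open>z\<close> and \<open>p\<close> the Navier condition reads
    \<open>b * z 0 - p 0 + (N - 1) * z 0 = 0\<close>, whence this coefficient;
    \<open>\<gamma> b * b \<le> 1\<close> holds because \<open>N - 1\<close> is positive.\<close>
  obtain b p z w2 where b: "b > 0" "z 0 = 1 / (real N - 1 + b) * p 0"
    and w: "C2_with {0..} (\<lambda>t. - z t) (\<lambda>t. b * z t - p t) w2"
    "\<forall>t\<ge>0. ode_at N lam g (\<lambda>t. - z t) (\<lambda>t. b * z t - p t) w2 t"
    "((\<lambda>t. - z t) \<longlongrightarrow> 0) at_top"
    by (rule half_line_solution[OF assms g, of "\<lambda>b. 1 / (real N - 1 + b)"]) (use m in auto)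
  have "(real N - 1 + b) * z 0 = p 0" using b m by simp
  then have "(b * z 0 - p 0) - (real N - 1) * (- z 0) = 0" by (simp add: algebra_simps)
  then have "solves_Nav N lam g (\<lambda>t. - z t)" unfolding solves_Nav_def using w by blast
  then show "\<exists>w. solves_Nav N lam g w" by blast
next
  fix g assume "g_hyp_E N g"
  then show "\<exists>w. solves_E N lam g w" using solves_E_exists assms by blast
qed

end
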